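(* For every positive integer $r$ there exists an analytically parametrized system $\Sigma=(M,U,\mathbb{X},\Lambda,p,f,\chi,h,\mu)$ with $\dim\mathbb{X}=r$ for which there is no universal distinguishing set of cardinality $2r$; that is, for every subset $\Lambda_0\subseteq\Lambda$ with exactly $2r$ elements there exist parameters $x_1,x_2\in\mathbb{X}$ such that $\beta_\Sigma(x_1,\lambda)\neq\beta_\Sigma(x_2,\lambda)$ for some $\lambda\in\Lambda$, but $\beta_\Sigma(x_1,\lambda)=\beta_\Sigma(x_2,\lambda)$ for all $\lambda\in\Lambda_0$. (Hence the number $2r+1$ of experiments sufficient for identification of analytically parametrized systems with $r$ parameters cannot be lowered to $2r$.)
   Context: An analytically parametrized system is a 9-tuple $\Sigma = (M, U, \mathbb{X}, \Lambda, p, f, \chi, h, \mu)$ where: $M$ (state space), $U$ (input-value space), $\mathbb{X}$ (parameter space) and $\Lambda$ (experiment space) are real-analytic manifolds, with $\mathbb{X}$ and $\Lambda$ connected and second countable and with $\Lambda$ having at least $2r$ points (automatic if $\dim\Lambda\ge 1$; the system asserted to exist has $\dim \Lambda\geq 1$); $p$ is a positive integer; $f: M\times U\times\mathbb{X}\to TM$, $\chi:\mathbb{X}\to M$, $h: M\times U\times\mathbb{X}\to\mathbb{R}^p$ and $\mu:\Lambda\times\mathbb{R}\to U$ are real-analytic maps; $f(z,u,x)\in T_zM$ for all $(z,u,x)$; and for each $x\in\mathbb{X}$, $\lambda\in\Lambda$, the solution $z(\cdot)$ of $\dot z(t)=f(z(t),\mu(\lambda,t),x)$, $z(0)=\chi(x)$,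 exists on the whole interval $[0,1]$. The response of $\Sigma$ is the map $\beta_\Sigma:\mathbb{X}\times\Lambda\to\mathbb{R}^p$, $\beta_\Sigma(x,\lambda):=h(z(1),\mu(\lambda,1),x)$, where $z$ is that solution. *)

theory Defs
  imports "HOL-Analysis.Analysis"
begin

text \<open>
  Dimensions have to be ordinary natural numbers here (they vary with \<open>r\<close>), so the model of
  $n$-dimensional space is the library's \<^const>\<open>Euclidean_space\<close> \<open>n\<close>: real sequences
  that vanish from index \<open>n\<close> on.
\<close>

subsection \<open>Real-analytic functions of several variables\<close>

text \<open>
  Convergent power series expansion around \<open>a\<close>, summed over the multi-indices supported in
  \<open>{..<m}\<close>. Only the values of \<open>g\<close> near \<open>a\<close> matter, because the radius may be shrunk.
\<close>

definition real_analytic_at :: "nat \<Rightarrow> ((nat \<Rightarrow> real) \<Rightarrow> real) \<Rightarrow> (nat \<Rightarrow> real) \<Rightarrow> bool" where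
  "real_analytic_at m g a \<longleftrightarrow>
     (\<exists>(c :: (nat \<Rightarrow> nat) \<Rightarrow> real) \<rho>. \<rho> > 0 \<and>
        (\<forall>x \<in> topspace (Euclidean_space m). (\<forall>i<m. \<bar>x i - a i\<bar> < \<rho>) \<longrightarrow>
           ((\<lambda>\<alpha>. c \<alpha> * (\<Prod>i<m. (x i - a i) ^ \<alpha> i)) has_sum g x) {\<alpha>. \<forall>i\<ge>m. \<alpha> i = 0}))"

text \<open>Used for sets \<open>S\<close> that are open in \<open>Euclidean_space m\<close>.\<close>

definition real_analytic_on ::
    "nat \<Rightarrow> nat \<Rightarrow> (nat \<Rightarrow> real) set \<Rightarrow> ((nat \<Rightarrow> real) \<Rightarrow> (nat \<Rightarrow> real)) \<Rightarrow> bool" where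
  "real_analytic_on m k S F \<longleftrightarrow> (\<forall>a\<in>S. \<forall>i<k. real_analytic_at m (\<lambda>x. F x i) a)"

definition partial_deriv ::
    "((nat \<Rightarrow> real) \<Rightarrow> (nat \<Rightarrow> real)) \<Rightarrow> nat \<Rightarrow> nat \<Rightarrow> (nat \<Rightarrow> real) \<Rightarrow> real" where
  "partial_deriv F i j a = deriv (\<lambda>t. F (a(j := t)) i) (a j)"

subsection \<open>Real-analytic manifolds\<close>

text \<open>
  A chart is a domain together with a coordinate map; the values of the coordinate map outside
  the domain are irrelevant. An atlas need not be maximal.
\<close>

type_synonym 'a chart = "'a set \<times> ('a \<Rightarrow> nat \<Rightarrow> real)"

record 'a mfd =
  mtop :: "'a topology"
  mdim :: nat
  atlas :: "'a chart set"

abbreviation mcarrier :: "'a mfd \<Rightarrow> 'a set" where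
  "mcarrier M \<equiv> topspace (mtop M)"

definition transition :: "'a chart \<Rightarrow> 'a chart \<Rightarrow> (nat \<Rightarrow> real) \<Rightarrow> (nat \<Rightarrow> real)" where
  "transition c c' = snd c' \<circ> inv_into (fst c) (snd c)"

definition analytic_manifold :: "'a mfd \<Rightarrow> bool" where
  "analytic_manifold M \<longleftrightarrow>
     Hausdorff_space (mtop M) \<and>
     (\<Union>c\<in>atlas M. fst c) = mcarrier M \<and>
     (\<forall>(D, \<phi>) \<in> atlas M.
        openin (mtop M) D \<and> openin (Euclidean_space (mdim M)) (\<phi> ` D) \<and>
        homeomorphic_map (subtopology (mtop M) D)
          (subtopology (Euclidean_space (mdim M)) (\<phi> ` D)) \<phi>) \<and>
     (\<forall>c \<in> atlas M. \<forall>c' \<in> atlas M.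
        real_analytic_on (mdim M) (mdim M) (snd c ` (fst c \<inter> fst c')) (transition c c'))"

definition analytic_map :: "'a mfd \<Rightarrow> 'b mfd \<Rightarrow> ('a \<Rightarrow> 'b) \<Rightarrow> bool" where
  "analytic_map M N F \<longleftrightarrow>
     continuous_map (mtop M) (mtop N) F \<and>
     (\<forall>(D, \<phi>) \<in> atlas M. \<forall>(E, \<psi>) \<in> atlas N.
        real_analytic_on (mdim M) (mdim N) (\<phi> ` {z \<in> D. F z \<in> E})
          (\<lambda>a. \<psi> (F (inv_into D \<phi> a))))"

definition euclid_mfd :: "nat \<Rightarrow> (nat \<Rightarrow> real) mfd" where
  "euclid_mfd n = \<lparr>mtop = Euclidean_space n, mdim = n,
                   atlas = {(topspace (Euclidean_space n), \<lambda>x. x)}\<rparr>"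

definition real_line :: "real mfd" where
  "real_line = \<lparr>mtop = euclideanreal, mdim = 1,
                atlas = {(UNIV, \<lambda>t i. if i = 0 then t else 0)}\<rparr>"

definition prod_chart :: "nat \<Rightarrow> 'a chart \<Rightarrow> 'b chart \<Rightarrow> ('a \<times> 'b) chart" where
  "prod_chart m c d =
     (fst c \<times> fst d, \<lambda>(x, y) i. if i < m then snd c x i else snd d y (i - m))"

definition prod_mfd :: "'a mfd \<Rightarrow> 'b mfd \<Rightarrow> ('a \<times> 'b) mfd" (infixr "\<times>\<^sub>m" 80) where
  "M \<times>\<^sub>m N = \<lparr>mtop = prod_topology (mtop M) (mtop N), mdim = mdim M + mdim N,
               atlas = {prod_chart (mdim M) c d | c d. c \<in> atlas M \<and> d \<in> atlas N}\<rparr>"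

subsection \<open>Tangent vectors and the tangent bundle\<close>

text \<open>
  A tangent vector at \<open>z\<close> is given by its components in every chart around \<open>z\<close>, where the
  components in different charts are related by the Jacobian matrix of the transition map
  (and are set to \<open>0\<close> for charts not around \<open>z\<close>, to make the representation unique).
\<close>

type_synonym 'a tvec = "'a chart \<Rightarrow> nat \<Rightarrow> real"

definition tangent_space :: "'a mfd \<Rightarrow> 'a \<Rightarrow> 'a tvec set" where
  "tangent_space M z =
     {v. (\<forall>c \<in> atlas M. z \<in> fst c \<longrightarrow> v c \<in> topspace (Euclidean_space (mdim M))) \<and>
         (\<forall>c \<in> atlas M. \<forall>c' \<in> atlas M. z \<in> fst c \<inter> fst c' \<longrightarrow>
            (\<forall>i < mdim M. v c' i =
               (\<Sum>j < mdim M. partial_deriv (transition c c') i j (snd c z) * v c j))) \<and>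
         (\<forall>c. \<not> (c \<in> atlas M \<and> z \<in> fst c) \<longrightarrow> v c = (\<lambda>_. 0))}"

definition tangent_points :: "'a mfd \<Rightarrow> ('a \<times> 'a tvec) set" where
  "tangent_points M = (SIGMA z : mcarrier M. tangent_space M z)"

definition tangent_chart :: "'a mfd \<Rightarrow> 'a chart \<Rightarrow> ('a \<times> 'a tvec) chart" where
  "tangent_chart M c =
     ({w \<in> tangent_points M. fst w \<in> fst c},
      \<lambda>(z, v) i. if i < mdim M then snd c z i else v c (i - mdim M))"

text \<open>The topology is the one that makes all charts induced from the atlas of \<open>M\<close> homeomorphisms
  onto open sets.\<close>

definition tangent_bundle :: "'a mfd \<Rightarrow> ('a \<times> 'a tvec) mfd" where
  "tangent_bundle M =
     \<lparr>mtop = topology_generated_by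
        {{w \<in> fst (tangent_chart M c). snd (tangent_chart M c) w \<in> V} | c V.
           c \<in> atlas M \<and> openin (Euclidean_space (2 * mdim M)) V},
      mdim = 2 * mdim M,
      atlas = tangent_chart M ` atlas M\<rparr>"

text \<open>The curve \<open>z\<close>, restricted to \<open>I\<close>, has velocity \<open>w\<close> (a point of the tangent bundle over
  \<open>z t\<close>) at time \<open>t\<close>; the derivative is one-sided at end points of \<open>I\<close>.\<close>

definition has_velocity ::
    "'a mfd \<Rightarrow> (real \<Rightarrow> 'a) \<Rightarrow> ('a \<times> 'a tvec) \<Rightarrow> real \<Rightarrow> real set \<Rightarrow> bool" where
  "has_velocity M z w t I \<longleftrightarrow>
     w \<in> tangent_points M \<and> fst w = z t \<and>
     (\<forall>c \<in> atlas M. z t \<in> fst c \<longrightarrow>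
        (\<forall>i < mdim M.
           ((\<lambda>s. snd c (z s) i) has_real_derivative snd w c i) (at t within I)))"

subsection \<open>Analytically parametrized systems\<close>

record ('m, 'u, 'x, 'l) param_system =
  state_mfd :: "'m mfd"                                         \<comment> \<open>$M$\<close>
  input_mfd :: "'u mfd"                                         \<comment> \<open>$U$\<close>
  param_mfd :: "'x mfd"                                         \<comment> \<open>$X$\<close>
  exper_mfd :: "'l mfd"                                         \<comment> \<open>$\Lambda$\<close>
  out_dim :: nat                                                \<comment> \<open>$p$\<close>
  dyn_map :: "'m \<times> 'u \<times> 'x \<Rightarrow> 'm \<times> 'm tvec"                    \<comment> \<open>$f$\<close>
  init_map :: "'x \<Rightarrow> 'm"                                        \<comment> \<open>$\chi$\<close>
  out_map :: "'m \<times> 'u \<times> 'x \<Rightarrow> nat \<Rightarrow> real"                      \<comment> \<open>$h$\<close>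
  inp_map :: "'l \<times> real \<Rightarrow> 'u"                                  \<comment> \<open>$\mu$\<close>

definition is_solution ::
    "('m, 'u, 'x, 'l) param_system \<Rightarrow> 'x \<Rightarrow> 'l \<Rightarrow> (real \<Rightarrow> 'm) \<Rightarrow> bool" where
  "is_solution S x l z \<longleftrightarrow>
     continuous_map (top_of_set {0..1}) (mtop (state_mfd S)) z \<and>
     z 0 = init_map S x \<and>
     (\<forall>t\<in>{0..1}. has_velocity (state_mfd S) z (dyn_map S (z t, inp_map S (l, t), x)) t {0..1})"

definition analytically_parametrized_system :: "('m, 'u, 'x, 'l) param_system \<Rightarrow> bool" where
  "analytically_parametrized_system S \<longleftrightarrow>
     analytic_manifold (state_mfd S) \<and> analytic_manifold (input_mfd S) \<and>
     analytic_manifold (param_mfd S) \<and> analytic_manifold (exper_mfd S) \<and>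
     connected_space (mtop (param_mfd S)) \<and> second_countable (mtop (param_mfd S)) \<and>
     connected_space (mtop (exper_mfd S)) \<and> second_countable (mtop (exper_mfd S)) \<and>
     (\<exists>L. L \<subseteq> mcarrier (exper_mfd S) \<and> finite L \<and> card L = 2 * mdim (param_mfd S)) \<and>
     0 < out_dim S \<and>
     analytic_map (state_mfd S \<times>\<^sub>m input_mfd S \<times>\<^sub>m param_mfd S)
       (tangent_bundle (state_mfd S)) (dyn_map S) \<and>
     analytic_map (param_mfd S) (state_mfd S) (init_map S) \<and>
     analytic_map (state_mfd S \<times>\<^sub>m input_mfd S \<times>\<^sub>m param_mfd S)
       (euclid_mfd (out_dim S)) (out_map S) \<and>
     analytic_map (exper_mfd S \<times>\<^sub>m real_line) (input_mfd S) (inp_map S) \<and>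
     (\<forall>z \<in> mcarrier (state_mfd S). \<forall>u \<in> mcarrier (input_mfd S). \<forall>x \<in> mcarrier (param_mfd S).
        fst (dyn_map S (z, u, x)) = z) \<and>
     (\<forall>x \<in> mcarrier (param_mfd S). \<forall>l \<in> mcarrier (exper_mfd S). \<exists>z. is_solution S x l z)"

text \<open>Solutions are unique only on \<open>[0,1]\<close>, hence the normalization outside that interval.\<close>

definition trajectory :: "('m, 'u, 'x, 'l) param_system \<Rightarrow> 'x \<Rightarrow> 'l \<Rightarrow> real \<Rightarrow> 'm" where
  "trajectory S x l = (THE z. z \<in> extensional {0..1} \<and> is_solution S x l z)"

definition response :: "('m, 'u, 'x, 'l) param_system \<Rightarrow> 'x \<Rightarrow> 'l \<Rightarrow> nat \<Rightarrow> real" where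
  "response S x l = out_map S (trajectory S x l 1, inp_map S (l, 1), x)"

definition distinguishable :: "('m, 'u, 'x, 'l) param_system \<Rightarrow> 'l set \<Rightarrow> 'x \<Rightarrow> 'x \<Rightarrow> bool" where
  "distinguishable S L x1 x2 \<longleftrightarrow> (\<exists>l\<in>L. response S x1 l \<noteq> response S x2 l)"

definition universal_distinguishing_set ::
    "('m, 'u, 'x, 'l) param_system \<Rightarrow> 'l set \<Rightarrow> bool" where
  "universal_distinguishing_set S L \<longleftrightarrow>
     L \<subseteq> mcarrier (exper_mfd S) \<and>
     (\<forall>x1 \<in> mcarrier (param_mfd S). \<forall>x2 \<in> mcarrier (param_mfd S).
        distinguishable S (mcarrier (exper_mfd S)) x1 x2 \<longrightarrow> distinguishable S L x1 x2)"

end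

theory Submission
  imports Defs "HOL-Computational_Algebra.Polynomial"
begin

text \<open>
  With trivial dynamics any analytic \<open>\<beta>(x, \<lambda>)\<close> is a response. Take
  $\beta(x,\lambda) = x_0 + x_0^3\theta + x_0^2\theta^2
    + \sum_{0<k<r} (x_k\theta^{2k+1} + x_k^2\theta^{2k+2})$ with
  $\theta = -(2r+1+\lambda^2)$. For experiments $\lambda_1,\dots,\lambda_{2r}$ the polynomial
  $Q = \prod_i (1 - X/\theta_i) = \sum_j q_j X^j$ has degree $2r$ and positive coefficients, and a
  positive multiple $cQ$ is a difference $\beta(s,\cdot) - \beta(t,\cdot)$, which vanishes at all
  $\lambda_i$ but not identically: each pair $(x_k, x_k^2)$ with $k > 0$ is a parabola, whose
  secants have all non-vertical directions, and the secants of $(x_0, x_0^3, x_0^2)$ realize the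
  directions $(1, q_1, q_2)$ with $3q_2^2 < 4q_1$. The latter holds as $q_1 = \sum_i -1/\theta_i < 1$
  and $q_2 \le q_1^2$.
\<close>

subsection \<open>Closure properties of analytic functions\<close>

text \<open>The expansion is required only at points of the model space. This is what allows chart
  inverses given by \<open>inv_into\<close> to be replaced by formulas that are correct only
  there.\<close>

lemma real_analytic_at_cong:
  assumes "real_analytic_at m g a"
    and "\<And>x. x \<in> topspace (Euclidean_space m) \<Longrightarrow> f x = g x"
  shows "real_analytic_at m f a"
  using assms unfolding real_analytic_at_def by fastforce

lemma real_analytic_at_const: "real_analytic_at m (\<lambda>x. v) a"
proof -
  let ?c = "\<lambda>\<alpha>. if \<alpha> = (\<lambda>_. 0) then v else 0 :: real"
  have "((\<lambda>\<alpha>. ?c \<alpha> * (\<Prod>i<m. (x i - a i) ^ \<alpha> i)) has_sum v) {\<alpha>. \<forall>i\<ge>m. \<alpha> i = 0}" for x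
    by (rule has_sum_finite_neutralI[where B = "{\<lambda>_. 0}"]) auto
  then show ?thesis
    unfolding real_analytic_at_def by (intro exI[of _ ?c] exI[of _ 1]) auto
qed

lemma real_analytic_at_add:
  assumes "real_analytic_at m f a" "real_analytic_at m g a"
  shows "real_analytic_at m (\<lambda>x. f x + g x) a"
proof -
  obtain c \<rho> where c: "\<rho> > 0" "\<And>x. x \<in> topspace (Euclidean_space m) \<Longrightarrow> \<forall>i<m. \<bar>x i - a i\<bar> < \<rho> \<Longrightarrow>
      ((\<lambda>\<alpha>. c \<alpha> * (\<Prod>i<m. (x i - a i) ^ \<alpha> i)) has_sum f x) {\<alpha>. \<forall>i\<ge>m. \<alpha> i = 0}"
    using assms(1) unfolding real_analytic_at_def by blast
  obtain d \<sigma> where d: "\<sigma> > 0" "\<And>x. x \<in> topspace (Euclidean_space m) \<Longrightarrow> \<forall>i<m. \<bar>x i - a i\<bar> < \<sigma> \<Longrightarrow>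
      ((\<lambda>\<alpha>. d \<alpha> * (\<Prod>i<m. (x i - a i) ^ \<alpha> i)) has_sum g x) {\<alpha>. \<forall>i\<ge>m. \<alpha> i = 0}"
    using assms(2) unfolding real_analytic_at_def by blast
  show ?thesis
    unfolding real_analytic_at_def
    by (intro exI[of _ "\<lambda>\<alpha>. c \<alpha> + d \<alpha>"] exI[of _ "min \<rho> \<sigma>"])
       (use c d in \<open>auto simp: distrib_right intro!: has_sum_add\<close>)
qed

lemma real_analytic_at_cmult:
  assumes "real_analytic_at m f a"
  shows "real_analytic_at m (\<lambda>x. k * f x) a"
proof -
  obtain c \<rho> where c: "\<rho> > 0" "\<And>x. x \<in> topspace (Euclidean_space m) \<Longrightarrow> \<forall>i<m. \<bar>x i - a i\<bar> < \<rho> \<Longrightarrow>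
      ((\<lambda>\<alpha>. c \<alpha> * (\<Prod>i<m. (x i - a i) ^ \<alpha> i)) has_sum f x) {\<alpha>. \<forall>i\<ge>m. \<alpha> i = 0}"
    using assms unfolding real_analytic_at_def by blast
  show ?thesis
    unfolding real_analytic_at_def
    by (intro exI[of _ "\<lambda>\<alpha>. k * c \<alpha>"] exI[of _ \<rho>])
       (use c in \<open>auto simp: mult.assoc intro!: has_sum_cmult_right\<close>)
qed

lemma real_analytic_at_sum:
  assumes "\<And>k. k \<in> K \<Longrightarrow> real_analytic_at m (f k) a"
  shows "real_analytic_at m (\<lambda>x. \<Sum>k\<in>K. f k x) a"
  using assms
  by (induction K rule: infinite_finite_induct)
     (auto intro: real_analytic_at_const real_analytic_at_add)

text \<open>Multiplication by this factor shifts the power series by one in index \<open>i\<close>,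
  so no Cauchy product is needed. All functions below are polynomials, hence reachable through such
  factors.\<close>

lemma real_analytic_at_shift_mult:
  assumes "real_analytic_at m f a" "i < m"
  shows "real_analytic_at m (\<lambda>x. (x i - a i) * f x) a"
proof -
  define A where "A = {\<alpha>::nat \<Rightarrow> nat. \<forall>j\<ge>m. \<alpha> j = 0}"
  define up where "up = (\<lambda>\<alpha>::nat \<Rightarrow> nat. \<alpha>(i := Suc (\<alpha> i)))"
  obtain c \<rho> where c: "\<rho> > 0" "\<And>x. x \<in> topspace (Euclidean_space m) \<Longrightarrow> \<forall>i<m. \<bar>x i - a i\<bar> < \<rho> \<Longrightarrow>
      ((\<lambda>\<alpha>. c \<alpha> * (\<Prod>i<m. (x i - a i) ^ \<alpha> i)) has_sum f x) A"
    using assms unfolding real_analytic_at_def A_def by blast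
  \<comment> \<open>The value 0 covers exactly the multi-indices in \<open>A\<close> outside the
    image of \<open>up\<close>; therefore the sum over that image extends to all of
    \<open>A\<close>.\<close>
  define c' where "c' = (\<lambda>\<alpha>. if \<alpha> i = 0 then 0 else c (\<alpha>(i := \<alpha> i - 1)))"
  have inj: "inj_on up A"
  proof (rule inj_onI)
    fix \<alpha> \<beta> assume "up \<alpha> = up \<beta>"
    then have "\<alpha> j = \<beta> j" for j
      by (cases "j = i") (auto simp: up_def dest: fun_cong[of _ _ j])
    then show "\<alpha> = \<beta>" by auto
  qed
  have prod_up: "(\<Prod>j<m. y j ^ up \<alpha> j) = y i * (\<Prod>j<m. y j ^ \<alpha> j)" for y :: "nat \<Rightarrow> real" and \<alpha>
  proof -
    have "(\<Prod>j\<in>{..<m}-{i}. y j ^ up \<alpha> j) = (\<Prod>j\<in>{..<m}-{i}. y j ^ \<alpha> j)"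
      by (rule prod.cong) (auto simp: up_def)
    then show ?thesis
      using assms(2) by (simp add: prod.remove[of "{..<m}" i] up_def)
  qed
  have "((\<lambda>\<alpha>. c' \<alpha> * (\<Prod>j<m. (x j - a j) ^ \<alpha> j)) has_sum ((x i - a i) * f x)) A"
    if "x \<in> topspace (Euclidean_space m)" "\<forall>j<m. \<bar>x j - a j\<bar> < \<rho>" for x
  proof -
    let ?t = "\<lambda>\<alpha>. c' \<alpha> * (\<Prod>j<m. (x j - a j) ^ \<alpha> j)"
    have "?t \<circ> up = (\<lambda>\<alpha>. (x i - a i) * (c \<alpha> * (\<Prod>j<m. (x j - a j) ^ \<alpha> j)))"
      unfolding o_def prod_up by (auto simp: c'_def up_def)
    then have "(?t has_sum ((x i - a i) * f x)) (up ` A)"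
      using has_sum_cmult_right[OF c(2)[OF that]] inj by (simp add: has_sum_reindex)
    moreover have "\<alpha> \<in> up ` A" if "\<alpha> \<in> A" "\<alpha> i \<noteq> 0" for \<alpha>
    proof
      show "\<alpha> = up (\<alpha>(i := \<alpha> i - 1))" using that by (auto simp: up_def)
      show "\<alpha>(i := \<alpha> i - 1) \<in> A" using that by (auto simp: A_def)
    qed
    moreover have "up ` A \<subseteq> A" using assms(2) by (auto simp: A_def up_def)
    ultimately show ?thesis
      by (subst has_sum_cong_neutral[where T = "up ` A" and g = ?t]) (auto simp: c'_def)
  qed
  then show ?thesis
    using c(1) unfolding real_analytic_at_def A_def by blast
qed

lemma real_analytic_at_coord_mult:
  assumes "real_analytic_at m f a" "i < m"
  shows "real_analytic_at m (\<lambda>x. x i * f x) a"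
proof -
  have "real_analytic_at m (\<lambda>x. (x i - a i) * f x + a i * f x) a"
    using assms by (intro real_analytic_at_add real_analytic_at_shift_mult real_analytic_at_cmult)
  then show ?thesis by (simp add: algebra_simps)
qed

lemma real_analytic_at_coord: "i < m \<Longrightarrow> real_analytic_at m (\<lambda>x. x i) a"
  using real_analytic_at_coord_mult[OF real_analytic_at_const[of _ 1]] by simp

lemma real_analytic_at_coord_power_mult:
  assumes "real_analytic_at m f a" "i < m"
  shows "real_analytic_at m (\<lambda>x. x i ^ n * f x) a"
  using assms by (induction n) (simp_all add: mult.assoc real_analytic_at_coord_mult)

subsection \<open>Euclidean spaces as manifolds\<close>

lemma continuous_map_Euclidean_space_coord:
  "continuous_map (Euclidean_space n) euclideanreal (\<lambda>x. x i)"
  unfolding Euclidean_space_def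
  by (intro continuous_map_from_subtopology) (metis UNIV_I continuous_map_product_coordinates)

lemma second_countable_Euclidean_space: "second_countable (Euclidean_space n)"
proof -
  obtain B :: "(nat \<Rightarrow> real) set set" where B: "countable B" "topological_basis B"
    using ex_countable_basis by auto
  have *: "\<exists>V\<in>B. x \<in> V \<and> V \<subseteq> U" if "open U" "x \<in> U" for U x
    by (rule topological_basisE[OF B(2) that]) (rule bexI, rule conjI)
  have "second_countable (euclidean :: (nat \<Rightarrow> real) topology)"
    unfolding second_countable_def
  proof (intro exI[of _ B] conjI ballI allI impI)
    show "openin euclidean V" if "V \<in> B" for V
      using topological_basis_open[OF B(2) that] by simp
    show "\<exists>V\<in>B. x \<in> V \<and> V \<subseteq> U" if "openin euclidean U \<and> x \<in> U" for U x
      using * that by simp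
  qed (rule B)
  then show ?thesis
    by (simp add: Euclidean_space_def euclidean_product_topology second_countable_subtopology)
qed

text \<open>The only transition map is \<open>inv_into\<close> of the identity, which is known to be
  the identity just on the model space.\<close>

lemma analytic_manifold_euclid: "analytic_manifold (euclid_mfd n)"
proof -
  have "real_analytic_at n (\<lambda>x. inv_into (topspace (Euclidean_space n)) (\<lambda>x. x) x i) a"
    if "i < n" for a i
    by (rule real_analytic_at_cong[OF real_analytic_at_coord[OF that]])
       (simp add: inv_into_f_f[of "\<lambda>x. x"])
  then show ?thesis
    by (auto simp: analytic_manifold_def euclid_mfd_def transition_def Hausdorff_Euclidean_space
        real_analytic_on_def o_def homeomorphic_map_id[unfolded id_def])
qed

subsection \<open>Secants of the parameter map\<close>

text \<open>The coefficients are the elementary symmetric polynomials in the positive numbers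
  \<open>b l\<close>; expanding the square of the first one yields the second one plus nonnegative
  terms.\<close>

lemma coeff_prod_linear:
  fixes b :: "'a \<Rightarrow> real"
  assumes "finite L" and "\<And>l. l \<in> L \<Longrightarrow> b l > 0"
  defines "Q \<equiv> \<Prod>l\<in>L. [:1, b l:]"
  shows "coeff Q 0 = 1" "coeff Q 1 = (\<Sum>l\<in>L. b l)" "coeff Q 2 \<le> (\<Sum>l\<in>L. b l)\<^sup>2"
    "n \<le> card L \<Longrightarrow> coeff Q n > 0" "n > card L \<Longrightarrow> coeff Q n = 0"
proof -
  \<comment> \<open>One induction carries all the facts, because the bound on coefficient 2 uses
    coefficient 1 and positivity uses the vanishing beyond the degree. \<open>Q\<close> is written
    out since it changes with \<open>L\<close>.\<close>
  have "coeff (\<Prod>l\<in>L. [:1, b l:]) 0 = 1 \<and> coeff (\<Prod>l\<in>L. [:1, b l:]) 1 = (\<Sum>l\<in>L. b l) \<and>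
      coeff (\<Prod>l\<in>L. [:1, b l:]) 2 \<le> (\<Sum>l\<in>L. b l)\<^sup>2 \<and>
      (\<forall>n. (n \<le> card L \<longrightarrow> coeff (\<Prod>l\<in>L. [:1, b l:]) n > 0) \<and>
           (n > card L \<longrightarrow> coeff (\<Prod>l\<in>L. [:1, b l:]) n = 0))"
    using assms(1,2)
  proof (induction L rule: finite_induct)
    case empty
    then show ?case by (auto simp: one_pCons coeff_pCons split: nat.splits)
  next
    case (insert l L)
    let ?Q = "\<Prod>l\<in>L. [:1, b l:]" and ?s = "\<Sum>l\<in>L. b l"
    have IH: "coeff ?Q 0 = 1" "coeff ?Q 1 = ?s" "coeff ?Q 2 \<le> ?s\<^sup>2"
      "\<And>n. n \<le> card L \<Longrightarrow> coeff ?Q n > 0" "\<And>n. n > card L \<Longrightarrow> coeff ?Q n = 0"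
      using insert by auto
    have b: "b l > 0" using insert.prems by simp
    have s: "?s \<ge> 0" by (rule sum_nonneg) (use insert.prems in \<open>simp add: less_imp_le\<close>)
    have rec0: "coeff ([:1, b l:] * ?Q) 0 = coeff ?Q 0" by simp
    have rec: "coeff ([:1, b l:] * ?Q) (Suc n) = coeff ?Q (Suc n) + b l * coeff ?Q n" for n
      by simp
    have ge0: "coeff ?Q n \<ge> 0" for n
      using IH(4,5)[of n] by (cases "n \<le> card L") auto
    have "coeff ([:1, b l:] * ?Q) n > 0" if "n \<le> Suc (card L)" for n
    proof (cases n)
      case 0
      then show ?thesis by (simp only: rec0 IH(1))
    next
      case (Suc k)
      then have "b l * coeff ?Q k > 0" using b IH(4) that by simp
      then show ?thesis using ge0[of "Suc k"] unfolding Suc rec by linarith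
    qed
    moreover have "coeff ([:1, b l:] * ?Q) n = 0" if n: "n > Suc (card L)" for n
    proof -
      obtain k where k: "n = Suc k" "k > card L" using n by (cases n) auto
      then show ?thesis using IH(5)[of k] IH(5)[of "Suc k"] by (simp only: rec k(1) mult_zero_right add_0)
    qed
    moreover have "coeff ([:1, b l:] * ?Q) 1 = b l + ?s"
      using rec[of 0] IH by simp
    moreover have "coeff ([:1, b l:] * ?Q) 2 \<le> (b l + ?s)\<^sup>2"
    proof -
      have "coeff ([:1, b l:] * ?Q) 2 = coeff ?Q 2 + b l * ?s"
        using rec[of 1] IH(2) by (simp only: numeral_2_eq_2 One_nat_def)
      also have "\<dots> \<le> (b l + ?s)\<^sup>2"
        using IH(3) mult_nonneg_nonneg[OF less_imp_le[OF b] s]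
        by (simp add: power2_sum) (smt (verit) zero_le_power2)
      finally show ?thesis .
    qed
    moreover have "coeff ([:1, b l:] * ?Q) 0 = 1" using rec0 IH(1) by simp
    ultimately show ?case
      unfolding prod.insert[OF insert.hyps] sum.insert[OF insert.hyps]
        card_insert_disjoint[OF insert.hyps] by blast
  qed
  then show "coeff Q 0 = 1" "coeff Q 1 = (\<Sum>l\<in>L. b l)" "coeff Q 2 \<le> (\<Sum>l\<in>L. b l)\<^sup>2"
    "n \<le> card L \<Longrightarrow> coeff Q n > 0" "n > card L \<Longrightarrow> coeff Q n = 0"
    unfolding Q_def by blast+
qed

section \<open>Secant directions of the response polynomial\<close>

lemma sum_atMost_double:
  fixes f :: "nat \<Rightarrow> real"
  shows "(\<Sum>j\<le>2 * r. f j) = f 0 + (\<Sum>k<r. f (2 * k + 1) + f (2 * k + 2))"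
  by (induction r) (simp_all add: algebra_simps)

text \<open>A polynomial in \<theta> with 2r + 1 coefficients built from r parameters. For
  \<open>k = 0\<close> the odd coefficient is a cube because \<open>x 0\<close> itself already
  serves as the constant term.\<close>

definition resp :: "nat \<Rightarrow> real \<Rightarrow> (nat \<Rightarrow> real) \<Rightarrow> real" where
  "resp r \<theta> x = x 0 + (\<Sum>k<r. (if k = 0 then x 0 ^ 3 else x k) * \<theta> ^ (2 * k + 1)
                                + (x k)\<^sup>2 * \<theta> ^ (2 * k + 2))"

text \<open>Two numbers with sum m and difference d have squares differing by m d and cubes
  differing by d (3 m^2 + d^2) / 4. Each pair of coefficients thus determines m and d, and the cube
  fixes the common scale \<open>c\<close>.\<close>

lemma resp_secant:
  fixes q :: "nat \<Rightarrow> real"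
  assumes "r > 0" and q0: "q 0 = 1" and pos: "\<And>n. n \<le> 2 * r \<Longrightarrow> q n > 0"
    and disc: "3 * (q 2)\<^sup>2 < 4 * q 1"
  obtains s t c where "s \<in> topspace (Euclidean_space r)" "t \<in> topspace (Euclidean_space r)"
    "c > 0" "\<And>\<theta>. resp r \<theta> s - resp r \<theta> t = c * (\<Sum>j\<le>2 * r. q j * \<theta> ^ j)"
proof -
  \<comment> \<open>The positive solution of 3 q_2^2 + c^2 = 4 q_1, the equation imposed by the
    cubes; \<open>disc\<close> makes it exist.\<close>
  define c where "c = sqrt (4 * q 1 - 3 * (q 2)\<^sup>2)"
  have c: "c > 0" "c\<^sup>2 = 4 * q 1 - 3 * (q 2)\<^sup>2" using disc by (auto simp: c_def)
  \<comment> \<open>\<open>d k\<close> and the following \<open>m k\<close> are the prescribed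
    difference and sum of \<open>s k\<close> and \<open>t k\<close>.\<close>
  define d where "d = (\<lambda>k. if k = 0 then c else c * q (2 * k + 1))"
  define m where "m = (\<lambda>k. if k = 0 then q 2 else q (2 * k + 2) / q (2 * k + 1))"
  define s where "s = (\<lambda>k. if k < r then (m k + d k) / 2 else 0)"
  define t where "t = (\<lambda>k. if k < r then (m k - d k) / 2 else 0)"
  have lin: "s 0 - t 0 = c" using \<open>r > 0\<close> by (simp add: s_def t_def d_def field_simps)
  have cube: "s 0 ^ 3 - t 0 ^ 3 = c * q 1"
  proof -
    have "s 0 ^ 3 - t 0 ^ 3 = c * (3 * (q 2)\<^sup>2 + c\<^sup>2) / 4"
      using \<open>r > 0\<close> by (simp add: s_def t_def d_def m_def power2_eq_square power3_eq_cube field_simps)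
    then show ?thesis using c(2) by simp
  qed
  have odd: "(if k = 0 then s 0 ^ 3 else s k) - (if k = 0 then t 0 ^ 3 else t k) = c * q (2 * k + 1)"
    if "k < r" for k
    using that cube by (auto simp: s_def t_def d_def field_simps)
  have even: "(s k)\<^sup>2 - (t k)\<^sup>2 = c * q (2 * k + 2)" if "k < r" for k
  proof -
    have "(s k)\<^sup>2 - (t k)\<^sup>2 = m k * d k"
      using that by (simp add: s_def t_def power2_eq_square field_simps)
    also have "\<dots> = c * q (2 * k + 2)"
      \<comment> \<open>Positivity cancels the denominator of \<open>m k\<close> for
        \<open>k > 0\<close>.\<close>
      using pos[of "2 * k + 1"] that by (auto simp: m_def d_def numeral_2_eq_2)
    finally show ?thesis .
  qed
  have diff: "resp r \<theta> s - resp r \<theta> t = c * (\<Sum>j\<le>2 * r. q j * \<theta> ^ j)" for \<theta>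
  proof -
    have "resp r \<theta> s - resp r \<theta> t = (s 0 - t 0) +
        (\<Sum>k<r. ((if k = 0 then s 0 ^ 3 else s k) - (if k = 0 then t 0 ^ 3 else t k)) * \<theta> ^ (2 * k + 1)
             + ((s k)\<^sup>2 - (t k)\<^sup>2) * \<theta> ^ (2 * k + 2))"
      unfolding resp_def left_diff_distrib sum.distrib sum_subtractf by simp
    also have "\<dots> = c * q 0 + (\<Sum>k<r. c * q (2 * k + 1) * \<theta> ^ (2 * k + 1) + c * q (2 * k + 2) * \<theta> ^ (2 * k + 2))"
      using lin odd even q0 by (intro arg_cong2[where f = "(+)"] sum.cong) auto
    also have "\<dots> = c * (\<Sum>j\<le>2 * r. q j * \<theta> ^ j)"
      unfolding sum_atMost_double by (simp add: sum_distrib_left distrib_left mult.assoc)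
    finally show ?thesis .
  qed
  have "s \<in> topspace (Euclidean_space r)" "t \<in> topspace (Euclidean_space r)"
    by (auto simp: s_def t_def topspace_Euclidean_space)
  then show ?thesis by (rule that[OF _ _ c(1) diff])
qed

section \<open>Parameters that 2r experiments cannot separate\<close>

text \<open>The negative sign gives the factors 1 - \<theta> / node positive coefficients; the
  offset 2r + 1 keeps the sum of 2r values -1 / node below 1.\<close>

definition node :: "nat \<Rightarrow> real \<Rightarrow> real" where
  "node r y = - (2 * real r + 1 + y\<^sup>2)"

lemma node_neg: "node r y < 0"
  unfolding node_def using zero_le_power2[of y] by linarith

text \<open>The difference of the two responses is a positive multiple of a polynomial vanishing at
  the given nodes and nowhere else. Elements of \<open>L\<close> with equal nodes merely produce a
  multiple root.\<close>

lemma resp_indistinguishable: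
  fixes Y :: "'a \<Rightarrow> real"
  assumes "r > 0" "finite L" "card L = 2 * r"
  obtains s t y where "s \<in> topspace (Euclidean_space r)" "t \<in> topspace (Euclidean_space r)"
    "\<And>l. l \<in> L \<Longrightarrow> resp r (node r (Y l)) s = resp r (node r (Y l)) t"
    "resp r (node r y) s \<noteq> resp r (node r y) t"
proof -
  define b where "b = (\<lambda>l. - 1 / node r (Y l))"
  define Q where "Q = (\<Prod>l\<in>L. [:1, b l:])"
  define \<sigma> where "\<sigma> = (\<Sum>l\<in>L. b l)"
  have b: "b l > 0" for l using node_neg[of r "Y l"] by (simp add: b_def divide_less_0_iff)
  note Q = coeff_prod_linear[OF assms(2), of b, folded Q_def \<sigma>_def, OF b]
  have "b l = 1 / (2 * real r + 1 + (Y l)\<^sup>2)" for l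
    unfolding b_def node_def by (rule minus_divide_divide)
  then have "b l \<le> 1 / (2 * real r + 1)" for l
    by (simp add: frac_le)
  then have "\<sigma> \<le> real (card L) * (1 / (2 * real r + 1))"
    unfolding \<sigma>_def by (intro sum_bounded_above)
  also have "\<dots> < 1" using assms(3) by simp
  finally have \<sigma>1: "\<sigma> < 1" .
  have \<sigma>0: "\<sigma> > 0" using Q(4)[of 1] Q(2) assms by simp
  have "coeff Q 2 > 0" using Q(4) assms by simp
  \<comment> \<open>With 0 < \<sigma> < 1 the chain gives q_2^2 \<le> \<sigma>^4 \<le> \<sigma> =
    q_1, hence 3 q_2^2 < 4 q_1.\<close>
  then have "(coeff Q 2)\<^sup>2 \<le> (\<sigma>\<^sup>2)\<^sup>2" using Q(3) by (intro power_mono) auto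
  also have "\<dots> = \<sigma> * \<sigma> ^ 3" by (simp add: power2_eq_square power3_eq_cube)
  also have "\<dots> \<le> \<sigma> * 1" using \<sigma>0 \<sigma>1 by (intro mult_left_mono power_le_one) auto
  finally have disc: "3 * (coeff Q 2)\<^sup>2 < 4 * coeff Q 1" using \<sigma>0 Q(2) by simp
  have pos: "coeff Q n > 0" if "n \<le> 2 * r" for n using that Q(4) assms(3) by simp
  obtain s t c where st: "s \<in> topspace (Euclidean_space r)" "t \<in> topspace (Euclidean_space r)"
    "c > 0" "\<And>\<theta>. resp r \<theta> s - resp r \<theta> t = c * (\<Sum>j\<le>2 * r. coeff Q j * \<theta> ^ j)"
    using resp_secant[of r "coeff Q", OF assms(1) Q(1) pos disc] by blast
  have "degree Q \<le> 2 * r" by (rule degree_le) (use Q(5) assms(3) in auto)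
  then have "(\<Sum>j\<le>2 * r. coeff Q j * \<theta> ^ j) = poly Q \<theta>" for \<theta>
    by (simp add: poly_altdef coeff_eq_0 sum.mono_neutral_right)
  then have diff: "resp r \<theta> s - resp r \<theta> t = c * (\<Prod>l\<in>L. 1 - \<theta> / node r (Y l))" for \<theta>
    using st(4) by (simp add: Q_def poly_prod b_def)
  \<comment> \<open>\<open>node\<close> is even in its argument, so a nonnegative \<open>y\<close>
    different from every absolute value yields a new node.\<close>
  obtain y where y: "y \<in> {0..}" "y \<notin> (\<lambda>l. \<bar>Y l\<bar>) ` L"
    by (meson assms(2) finite_imageI finite_subset infinite_Ici subsetI)
  have ne: "1 - node r y / node r (Y l) \<noteq> 0" if "l \<in> L" for l
  proof
    assume "1 - node r y / node r (Y l) = 0"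
    then have "node r y = node r (Y l)" using node_neg[of r "Y l"] by simp
    then have "y = \<bar>Y l\<bar>" using y(1) by (simp add: node_def power2_eq_iff) auto
    then show False using y(2) that by blast
  qed
  then have "(\<Prod>l\<in>L. 1 - node r y / node r (Y l)) \<noteq> 0"
    using ne by (simp only: prod_zero_iff[OF assms(2)]) blast
  then have neq: "resp r (node r y) s \<noteq> resp r (node r y) t"
    using diff[of "node r y"] st(3) by auto
  have eq: "resp r (node r (Y l)) s = resp r (node r (Y l)) t" if "l \<in> L" for l
  proof -
    have "(\<Prod>l'\<in>L. 1 - node r (Y l) / node r (Y l')) = 0"
      using that assms(2) node_neg[of r "Y l"] by (intro prod_zero bexI[of _ l]) auto
    then show ?thesis using diff[of "node r (Y l)"] by simp
  qed
  show ?thesis by (rule that[OF st(1,2) eq neq])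
qed

subsection \<open>The system\<close>

text \<open>The state space is a single point, and the input is the experiment itself at all times,
  so the response is \<open>out_map\<close> in disguise. The zero padding keeps outputs inside
  \<open>Euclidean_space 1\<close>.\<close>

definition sharp_system ::
    "nat \<Rightarrow> (nat \<Rightarrow> real, nat \<Rightarrow> real, nat \<Rightarrow> real, nat \<Rightarrow> real) param_system" where
  "sharp_system r =
     \<lparr>state_mfd = euclid_mfd 0, input_mfd = euclid_mfd 1, param_mfd = euclid_mfd r,
      exper_mfd = euclid_mfd 1, out_dim = 1,
      dyn_map = (\<lambda>(z, u, x). (z, \<lambda>_ _. 0)),
      init_map = (\<lambda>_ _. 0),
      out_map = (\<lambda>(z, u, x) i. if i < 1 then resp r (node r (u 0)) x else 0),
      inp_map = fst\<rparr>"

lemma sharp_system_simps [simp]: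
  "state_mfd (sharp_system r) = euclid_mfd 0" "input_mfd (sharp_system r) = euclid_mfd 1"
  "param_mfd (sharp_system r) = euclid_mfd r" "exper_mfd (sharp_system r) = euclid_mfd 1"
  "out_dim (sharp_system r) = 1" "init_map (sharp_system r) = (\<lambda>_ _. 0)"
  "dyn_map (sharp_system r) (z, u, x) = (z, \<lambda>_ _. 0)"
  "out_map (sharp_system r) (z, u, x) = (\<lambda>i. if i < 1 then resp r (node r (u 0)) x else 0)"
  "inp_map (sharp_system r) = fst"
  by (simp_all add: sharp_system_def)

lemma euclid_mfd_simps [simp]:
  "mtop (euclid_mfd n) = Euclidean_space n" "mdim (euclid_mfd n) = n"
  "atlas (euclid_mfd n) = {(topspace (Euclidean_space n), \<lambda>x. x)}"
  by (simp_all add: euclid_mfd_def)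

lemma prod_mfd_simps [simp]:
  "mtop (M \<times>\<^sub>m N) = prod_topology (mtop M) (mtop N)" "mdim (M \<times>\<^sub>m N) = mdim M + mdim N"
  "atlas (M \<times>\<^sub>m N) = {prod_chart (mdim M) c d | c d. c \<in> atlas M \<and> d \<in> atlas N}"
  by (simp_all add: prod_mfd_def)

lemma real_line_simps [simp]:
  "mtop real_line = euclideanreal" "mdim real_line = 1"
  "atlas real_line = {(UNIV, \<lambda>t i. if i = 0 then t else 0)}"
  by (simp_all add: real_line_def)

text \<open>The output is constant in the state, so the trajectory drops out without being
  computed.\<close>

lemma response_sharp_system:
  "response (sharp_system r) x l = (\<lambda>i. if i < 1 then resp r (node r (l 0)) x else 0)"
  by (simp add: response_def)

section \<open>Regularity of the output and input maps\<close>

lemma real_analytic_at_node_mult: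
  assumes "real_analytic_at m f a" "i < m"
  shows "real_analytic_at m (\<lambda>y. node r (y i) * f y) a"
proof -
  have "real_analytic_at m (\<lambda>y. - (2 * real r + 1) * f y + (-1) * (y i * (y i * f y))) a"
    by (intro real_analytic_at_add real_analytic_at_cmult real_analytic_at_coord_mult assms)
  then show ?thesis
    by (rule real_analytic_at_cong) (simp add: node_def power2_eq_square algebra_simps)
qed

lemma real_analytic_at_node_power:
  assumes "i < m"
  shows "real_analytic_at m (\<lambda>y. node r (y i) ^ n) a"
  by (induction n) (simp_all add: real_analytic_at_const real_analytic_at_node_mult assms)

text \<open>This is the output in the product chart: the state has no coordinates, coordinate 0 is
  the input, and coordinate \<open>Suc k\<close> is parameter \<open>k\<close>.\<close>

lemma real_analytic_at_resp:
  assumes "r > 0"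
  shows "real_analytic_at (Suc r) (\<lambda>y. resp r (node r (y 0)) (\<lambda>k. y (Suc k))) a"
proof -
  have "real_analytic_at (Suc r) (\<lambda>y. (if k = 0 then y (Suc 0) ^ 3 else y (Suc k)) * node r (y 0) ^ n) a"
    if "k < r" for k n
    using that assms real_analytic_at_node_power[of 0 "Suc r"]
    by (cases "k = 0") (auto intro: real_analytic_at_coord_power_mult real_analytic_at_coord_mult)
  then show ?thesis
    using assms unfolding resp_def
    by (intro real_analytic_at_add real_analytic_at_coord real_analytic_at_sum
        real_analytic_at_coord_power_mult real_analytic_at_node_power) (simp_all del: power_Suc)
qed

lemma continuous_map_resp:
  "continuous_map (prod_topology T (prod_topology (Euclidean_space 1) (Euclidean_space r)))
     euclideanreal (\<lambda>(z, u, x). resp r (node r (u 0)) x)"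
proof -
  let ?P = "prod_topology T (prod_topology (Euclidean_space 1) (Euclidean_space r))"
  have u: "continuous_map ?P euclideanreal (\<lambda>p. fst (snd p) i)" for i
    using continuous_map_compose[OF continuous_map_compose[OF continuous_map_snd continuous_map_fst]
        continuous_map_Euclidean_space_coord] by (simp add: o_def)
  have x: "continuous_map ?P euclideanreal (\<lambda>p. snd (snd p) i)" for i
    using continuous_map_compose[OF continuous_map_compose[OF continuous_map_snd continuous_map_snd]
        continuous_map_Euclidean_space_coord] by (simp add: o_def)
  have c: "continuous_map ?P euclideanreal (\<lambda>p. if k = 0 then snd (snd p) 0 ^ 3 else snd (snd p) k)" for k
    using x[of k] continuous_map_real_pow[OF x[of 0]] by (cases "k = 0") simp_all
  show ?thesis
    unfolding resp_def node_def case_prod_unfold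
    by (intro continuous_map_add continuous_map_real_mult continuous_map_real_pow
        continuous_map_minus continuous_map_sum continuous_map_const[THEN iffD2] u x c) auto
qed

lemma analytic_map_out:
  assumes "r > 0"
  shows "analytic_map (euclid_mfd 0 \<times>\<^sub>m euclid_mfd 1 \<times>\<^sub>m euclid_mfd r) (euclid_mfd 1)
           (out_map (sharp_system r))"
proof -
  let ?c = "prod_chart 0 (topspace (Euclidean_space 0), \<lambda>x. x)
              (prod_chart 1 (topspace (Euclidean_space 1), \<lambda>x. x) (topspace (Euclidean_space r), \<lambda>x. x))"
  have cont: "continuous_map (prod_topology (Euclidean_space 0) (prod_topology (Euclidean_space 1) (Euclidean_space r)))
      (Euclidean_space 1) (\<lambda>p i. if i < 1 then (case p of (z, u, x) \<Rightarrow> resp r (node r (u 0)) x) else 0)"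
    unfolding continuous_map_componentwise_Euclidean_space using continuous_map_resp by blast
  have val: "out_map (sharp_system r) (inv_into (fst ?c) (snd ?c) y) 0
        = resp r (node r (y 0)) (\<lambda>k. y (Suc k))"
    if "y \<in> topspace (Euclidean_space (Suc r))" for y
  proof -
    \<comment> \<open>An explicit preimage shows that \<open>y\<close> lies in the range of the
      chart; \<open>inv_into\<close> then returns a point whose coordinates can be read off from
      \<open>y\<close>.\<close>
    have "y = snd ?c ((\<lambda>_. 0), (\<lambda>i. if i = 0 then y 0 else 0), (\<lambda>i. y (Suc i)))"
      by (auto simp: prod_chart_def)
    moreover have "((\<lambda>_. 0), (\<lambda>i. if i = 0 then y 0 else 0), (\<lambda>i. y (Suc i))) \<in> fst ?c"
      using that by (auto simp: prod_chart_def topspace_Euclidean_space)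
    ultimately have "y \<in> snd ?c ` fst ?c" by (rule image_eqI)
    then have y: "snd ?c (inv_into (fst ?c) (snd ?c) y) = y" by (rule f_inv_into_f)
    obtain z u x where p: "inv_into (fst ?c) (snd ?c) y = (z, u, x)" by (metis prod.exhaust)
    have "u 0 = y 0" using fun_cong[OF y, of 0] unfolding p by (simp add: prod_chart_def)
    moreover have "x k = y (Suc k)" for k
      using fun_cong[OF y, of "Suc k"] unfolding p by (simp add: prod_chart_def)
    then have "x = (\<lambda>k. y (Suc k))" by auto
    ultimately show ?thesis unfolding p by simp
  qed
  have "real_analytic_at (Suc r) (\<lambda>y. out_map (sharp_system r) (inv_into (fst ?c) (snd ?c) y) 0) a" for a
    by (rule real_analytic_at_cong[OF real_analytic_at_resp[OF assms] val])
  then have "real_analytic_on (mdim (euclid_mfd 0 \<times>\<^sub>m euclid_mfd 1 \<times>\<^sub>m euclid_mfd r)) 1 S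
      (\<lambda>y. out_map (sharp_system r) (inv_into (fst ?c) (snd ?c) y))" for S
    by (simp add: real_analytic_on_def)
  moreover have "atlas (euclid_mfd 0 \<times>\<^sub>m euclid_mfd 1 \<times>\<^sub>m euclid_mfd r) = {?c}"
    by (simp del: split_paired_Ex)
  moreover have "out_map (sharp_system r) = (\<lambda>p i. if i < 1 then (case p of (z, u, x) \<Rightarrow> resp r (node r (u 0)) x) else 0)"
    by (auto simp: sharp_system_def)
  ultimately show ?thesis
    using cont unfolding analytic_map_def case_prod_unfold
    by (simp only: prod_mfd_simps euclid_mfd_simps) simp
qed

lemma analytic_map_inp:
  "analytic_map (euclid_mfd n \<times>\<^sub>m real_line) (euclid_mfd n) fst"
proof -
  let ?c = "prod_chart n (topspace (Euclidean_space n), \<lambda>x. x)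
              (UNIV :: real set, \<lambda>t i. if i = 0 then t else 0)"
  have val: "fst (inv_into (fst ?c) (snd ?c) y) i = y i"
    if "y \<in> topspace (Euclidean_space (Suc n))" "i < n" for y i
  proof -
    \<comment> \<open>The last coordinate, of index \<open>n\<close>, is time.\<close>
    have "y = snd ?c ((\<lambda>i. if i < n then y i else 0), y n)"
      using that by (auto simp: prod_chart_def topspace_Euclidean_space)
    moreover have "((\<lambda>i. if i < n then y i else 0), y n) \<in> fst ?c"
      by (auto simp: prod_chart_def topspace_Euclidean_space)
    ultimately have "y \<in> snd ?c ` fst ?c" by (rule image_eqI)
    then have y: "snd ?c (inv_into (fst ?c) (snd ?c) y) = y" by (rule f_inv_into_f)
    show ?thesis
      using fun_cong[OF y, of i] that(2)
      by (cases "inv_into (fst ?c) (snd ?c) y") (simp add: prod_chart_def)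
  qed
  have "real_analytic_at (Suc n) (\<lambda>y. fst (inv_into (fst ?c) (snd ?c) y) i) a" if "i < n" for i a
    by (rule real_analytic_at_cong[OF real_analytic_at_coord val]) (use that in auto)
  then show ?thesis
    unfolding analytic_map_def real_analytic_on_def
    by (auto split: prod.splits simp: continuous_map_fst)
qed

section \<open>The zero vector field on a point, and the assembled system\<close>

lemma zero_tangent_point: "((\<lambda>_. 0), (\<lambda>_ _. 0)) \<in> tangent_points (euclid_mfd 0)"
  by (auto simp: tangent_points_def tangent_space_def topspace_Euclidean_space)

text \<open>On the domain this is a constant map, as the state is always the origin. Analyticity is
  vacuous in a bundle of dimension 0; what remains is that \<open>?w\<close> lies in the generated
  topological space, witnessed by the basic open set \<open>?D\<close>.\<close>

lemma analytic_map_dyn: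
  "analytic_map (euclid_mfd 0 \<times>\<^sub>m euclid_mfd 1 \<times>\<^sub>m euclid_mfd r) (tangent_bundle (euclid_mfd 0))
     (dyn_map (sharp_system r))"
proof -
  let ?w = "((\<lambda>_. 0), (\<lambda>_ _. 0)) :: (nat \<Rightarrow> real) \<times> (nat \<Rightarrow> real) tvec"
  let ?c = "(topspace (Euclidean_space 0), \<lambda>x. x) :: (nat \<Rightarrow> real) chart"
  let ?P = "prod_topology (Euclidean_space 0) (prod_topology (Euclidean_space 1) (Euclidean_space r))"
  let ?D = "{w \<in> fst (tangent_chart (euclid_mfd 0) ?c).
              snd (tangent_chart (euclid_mfd 0) ?c) w \<in> topspace (Euclidean_space (2 * 0))}"
  have "openin (mtop (tangent_bundle (euclid_mfd 0))) ?D"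
    unfolding tangent_bundle_def mfd.select_convs euclid_mfd_simps
    by (rule topology_generated_by_Basis, rule CollectI,
        rule exI[of _ ?c], rule exI[of _ "topspace (Euclidean_space (2 * 0))"]) simp
  moreover have "?w \<in> ?D"
    using zero_tangent_point by (simp add: tangent_chart_def topspace_Euclidean_space)
  ultimately have "?w \<in> topspace (mtop (tangent_bundle (euclid_mfd 0)))"
    using openin_subset by blast
  then have "continuous_map ?P (mtop (tangent_bundle (euclid_mfd 0))) (\<lambda>_. ?w)"
    by simp
  moreover have "?w = dyn_map (sharp_system r) p" if "p \<in> topspace ?P" for p
    using that by (auto simp: topspace_Euclidean_space fun_eq_iff)
  ultimately have "continuous_map ?P (mtop (tangent_bundle (euclid_mfd 0))) (dyn_map (sharp_system r))"
    by (rule continuous_map_eq)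
  then show ?thesis
    unfolding analytic_map_def real_analytic_on_def by (auto simp: tangent_bundle_def)
qed

lemma analytically_parametrized_sharp_system:
  assumes "r > 0"
  shows "analytically_parametrized_system (sharp_system r)"
proof -
  have "is_solution (sharp_system r) x l (\<lambda>_ _. 0)" for x l
    using zero_tangent_point
    by (simp add: is_solution_def has_velocity_def topspace_Euclidean_space)
  then have sol: "\<exists>z. is_solution (sharp_system r) x l z" for x l
    by blast
  have init: "analytic_map (euclid_mfd r) (euclid_mfd 0) (\<lambda>_ _. 0)"
    by (simp add: analytic_map_def real_analytic_on_def topspace_Euclidean_space)
  \<comment> \<open>A copy of the natural numbers in the experiment line supplies finite sets of
    every size.\<close>
  have exper: "\<exists>L. L \<subseteq> topspace (Euclidean_space 1) \<and> finite L \<and> card L = 2 * r"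
  proof -
    have "inj (\<lambda>(t::nat) i. if i = (0::nat) then real t else 0)"
      by (rule injI) (metis of_nat_eq_iff)
    then have "infinite (range (\<lambda>(t::nat) i. if i = (0::nat) then real t else 0))"
      by (simp add: finite_image_iff)
    moreover have "range (\<lambda>(t::nat) i. if i = (0::nat) then real t else 0) \<subseteq> topspace (Euclidean_space 1)"
      by (auto simp: topspace_Euclidean_space)
    ultimately show ?thesis
      by (meson infinite_arbitrarily_large infinite_super)
  qed
  show ?thesis
    unfolding analytically_parametrized_system_def sharp_system_simps euclid_mfd_simps
    by (intro conjI ballI zero_less_one analytic_manifold_euclid connected_Euclidean_space
        second_countable_Euclidean_space exper init sol analytic_map_out[OF assms]
        analytic_map_inp analytic_map_dyn) simp
qed

theorem mainTheorem2:
  fixes r :: nat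
  assumes "0 < r"
  shows "\<exists>S :: (nat \<Rightarrow> real, nat \<Rightarrow> real, nat \<Rightarrow> real, nat \<Rightarrow> real) param_system.
           analytically_parametrized_system S \<and>
           mdim (param_mfd S) = r \<and>
           1 \<le> mdim (exper_mfd S) \<and>
           \<not> (\<exists>L. card L = 2 * r \<and> universal_distinguishing_set S L)"
proof (intro exI[of _ "sharp_system r"] conjI notI)
  assume "\<exists>L. card L = 2 * r \<and> universal_distinguishing_set (sharp_system r) L"
  then obtain L where card: "card L = 2 * r" and L: "universal_distinguishing_set (sharp_system r) L"
    by blast
  \<comment> \<open>Infinite sets have \<open>card\<close> 0, while 2r is positive.\<close>
  have "finite L" using card assms by (intro card_ge_0_finite) simp
  then obtain s t y where st: "s \<in> topspace (Euclidean_space r)" "t \<in> topspace (Euclidean_space r)"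
    "\<And>l. l \<in> L \<Longrightarrow> resp r (node r (l 0)) s = resp r (node r (l 0)) t"
    "resp r (node r y) s \<noteq> resp r (node r y) t"
    using resp_indistinguishable[OF assms _ card, of "\<lambda>l. l 0"] by blast
  have "(\<lambda>i. if i = 0 then y else 0) \<in> topspace (Euclidean_space 1)"
    by (auto simp: topspace_Euclidean_space)
  moreover have "response (sharp_system r) s (\<lambda>i. if i = 0 then y else 0)
      \<noteq> response (sharp_system r) t (\<lambda>i. if i = 0 then y else 0)"
    using st(4) by (auto simp: response_sharp_system dest: fun_cong[of _ _ 0])
  ultimately have "distinguishable (sharp_system r) (topspace (Euclidean_space 1)) s t"
    unfolding distinguishable_def by blast
  then have "distinguishable (sharp_system r) L s t"
    using L st(1,2) by (simp add: universal_distinguishing_set_def)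
  then obtain l where "l \<in> L" "response (sharp_system r) s l \<noteq> response (sharp_system r) t l"
    unfolding distinguishable_def by blast
  then show False
    unfolding response_sharp_system st(3)[OF \<open>l \<in> L\<close>] by simp
qed (simp_all add: assms analytically_parametrized_sharp_system)

end
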